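(* There exist infinitely many real quadratic fields that have PWR ideals. Furthermore, any two PWR ideals lying in distinct real quadratic fields are non-similar. Consequently, there are infinitely many pairwise non-similar PWR ideals of real quadratic fields.
   Context: For a real quadratic field $K=\mathbb{Q}(\sqrt d)$ ($d>1$ squarefree), let $\Lambda:K\to\mathbb{R}^2$, $\Lambda(\alpha)=(\sigma_1(\alpha),\sigma_2(\alpha))$ where $\sigma_{1,2}(x+y\sqrt d)=x\pm y\sqrt d$. A lattice in $\mathbb{R}^2$ is well-rounded (WR) if its nonzero vectors of minimal Euclidean length span $\mathbb{R}^2$. A nonzero integral ideal $I$ of $O_K$ is PWR if it is principal and $\Lambda(I)$ is WR. Two lattices $L_1,L_2$ are similar if $L_2=\gamma UL_1$ with $\gamma>0$ real and $U$ a real orthogonal $2\times2$ matrix; ideals are similar if their lattices are. *)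

theory Defs
  imports
    "HOL-Analysis.Analysis"
    "HOL-Algebra.Ideal"
    "HOL-Computational_Algebra.Polynomial"
    "HOL-Computational_Algebra.Squarefree"
begin

text \<open>
  A real quadratic field is realised as the subfield of \<real> generated by \<open>sqrt d\<close>, for
  \<open>d > 1\<close> squarefree, so that the first real embedding is the inclusion. All definitions take
  the radicand \<open>d\<close> as an argument; the condition on \<open>d\<close> is stated in \<open>quad_radicand\<close>.
\<close>

definition quad_radicand :: "nat \<Rightarrow> bool" where
  "quad_radicand d \<longleftrightarrow> d > 1 \<and> squarefree d"

definition quad_field :: "nat \<Rightarrow> real set" where
  "quad_field d = {of_rat x + of_rat y * sqrt (real d) | x y :: rat. True}"

text \<open>
  The description below determines the value uniquely for \<open>\<alpha>\<close> in \<open>quad_field d\<close>, because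
  \<open>sqrt d\<close> is irrational for the admissible \<open>d\<close>; other arguments are irrelevant.
\<close>

definition quad_conj :: "nat \<Rightarrow> real \<Rightarrow> real" where
  "quad_conj d \<alpha> = (THE \<beta>. \<exists>x y :: rat. \<alpha> = of_rat x + of_rat y * sqrt (real d) \<and>
                                       \<beta> = of_rat x - of_rat y * sqrt (real d))"

definition Lambda :: "nat \<Rightarrow> real \<Rightarrow> real ^ 2" where
  "Lambda d \<alpha> = vector [\<alpha>, quad_conj d \<alpha>]"

definition quad_int_ring :: "nat \<Rightarrow> real ring" where
  "quad_int_ring d =
     \<lparr>carrier = {\<alpha> \<in> quad_field d. algebraic_int \<alpha>},
      mult = (*), one = 1, zero = 0, add = (+)\<rparr>"

text \<open>
  The next three notions are meant for lattices in the plane, but make sense for every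
  set of vectors. They are only applied to \<open>Lambda d ` I\<close> for \<open>I\<close> a nonzero ideal of
  \<open>quad_int_ring d\<close>, which is a lattice.
\<close>

definition minimal_vectors :: "(real ^ 2) set \<Rightarrow> (real ^ 2) set" where
  "minimal_vectors L = {v \<in> L. v \<noteq> 0 \<and> (\<forall>w \<in> L. w \<noteq> 0 \<longrightarrow> norm v \<le> norm w)}"

definition well_rounded :: "(real ^ 2) set \<Rightarrow> bool" where
  "well_rounded L \<longleftrightarrow> span (minimal_vectors L) = UNIV"

definition similar_lattices :: "(real ^ 2) set \<Rightarrow> (real ^ 2) set \<Rightarrow> bool" where
  "similar_lattices L1 L2 \<longleftrightarrow>
     (\<exists>\<gamma> > 0. \<exists>U :: real ^ 2 ^ 2. orthogonal_matrix U \<and> L2 = (\<lambda>v. \<gamma> *\<^sub>R (U *v v)) ` L1)"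

definition PWR_ideal :: "nat \<Rightarrow> real set \<Rightarrow> bool" where
  "PWR_ideal d I \<longleftrightarrow>
     principalideal I (quad_int_ring d) \<and> I \<noteq> {0} \<and> well_rounded (Lambda d ` I)"

definition similar_ideals :: "nat \<Rightarrow> real set \<Rightarrow> nat \<Rightarrow> real set \<Rightarrow> bool" where
  "similar_ideals d1 I1 d2 I2 \<longleftrightarrow> similar_lattices (Lambda d1 ` I1) (Lambda d2 ` I2)"

end

theory Submission
  imports Defs
begin

text \<open>
  For vectors \<open>v\<close>, \<open>w\<close> of \<open>\<Lambda>(K)\<close> with \<open>K = \<rat>(\<surd>d)\<close>, the determinant of \<open>(v, w)\<close> is a rational
  multiple of \<open>\<surd>d\<close> and \<open>|v|\<^sup>2\<close> is rational. Their quotient is preserved up to sign by similarities,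
  so a similarity between two ideals of rank two forces \<open>\<surd>d\<^sub>1 / \<surd>d\<^sub>2\<close> to be rational.

  For existence, let \<open>n\<close> be odd with \<open>n\<close> and \<open>n + 2\<close> squarefree and put \<open>d = n (n + 2)\<close>. Then \<open>d\<close> is
  squarefree and congruent to 3 modulo 4, so the ring of integers is \<open>\<int>[\<surd>d]\<close>. The unit
  \<open>\<epsilon> = n + 1 + \<surd>d\<close> carries \<open>- n + \<surd>d\<close> to \<open>n + \<surd>d\<close>, so the ideal generated by \<open>n + \<surd>d\<close> contains
  both. It consists of the numbers \<open>n r + t \<surd>d\<close> with \<open>r \<equiv> t\<close> modulo 2, of squared length
  \<open>2 n (n r\<^sup>2 + (n + 2) t\<^sup>2)\<close>, which is minimal at \<open>r = \<plusminus>1\<close>, \<open>t = \<plusminus>1\<close>. A counting argument gives infinitely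
  many such \<open>n\<close>.
\<close>

subsection \<open>Arithmetic of quadratic fields\<close>

text \<open>Content is multiplicative and \<open>g\<close> is primitive, so \<open>c\<close> divides
  the content of the cofactor \<open>h\<close> and cancels on both sides.\<close>

lemma primitive_dvd_smult_imp_dvd:
  fixes f g :: "int poly"
  assumes "g dvd smult c f" "content g = 1" "c \<noteq> 0"
  shows "g dvd f"
proof -
  obtain h where h: "smult c f = g * h"
    using assms(1) by (elim dvdE)
  have "content h = normalize c * content f"
    using arg_cong[OF h, of content] assms(2) by (simp add: content_mult)
  then have "c dvd content h"
    by simp
  then obtain k where "h = smult c k"
    using const_poly_dvd_iff_dvd_content[of c h] by (auto elim!: dvdE)
  then have "smult c f = smult c (g * k)"
    using h by simp
  then have "f = g * k"
    using assms(3) by (metis smult_cancel)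
  then show ?thesis by simp
qed

lemma map_poly_of_int_add:
  "map_poly of_int (p + q) = map_poly of_int p + (map_poly of_int q :: 'a::comm_ring_1 poly)"
  by (rule poly_eqI) (simp add: coeff_map_poly)

lemma map_poly_of_int_mult:
  "map_poly of_int (p * q) = map_poly of_int p * (map_poly of_int q :: 'a::comm_ring_1 poly)"
  by (rule poly_eqI) (simp add: coeff_map_poly coeff_mult)

text \<open>
  Pseudo-division by \<open>g\<close> leaves a linear remainder vanishing at the irrational \<open>\<alpha>\<close>, hence none, so \<open>g\<close>
  divides a monic polynomial by Gauss's lemma.
\<close>

lemma lead_coeff_primitive_quadratic_algebraic_int:
  fixes g :: "int poly" and \<alpha> :: real
  assumes "algebraic_int \<alpha>" "\<alpha> \<notin> \<rat>" "content g = 1" "degree g = 2"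
    and root: "poly (map_poly of_int g) \<alpha> = 0"
  shows "lead_coeff g dvd 1"
proof -
  obtain p :: "int poly" where p: "poly (map_poly of_int p) \<alpha> = 0" "lead_coeff p = 1"
    using assms(1) by (auto simp: algebraic_int_altdef_ipoly)
  have g0: "g \<noteq> 0" using assms(4) by auto
  obtain q r where qr: "pseudo_divmod p g = (q, r)" by fastforce
  define c where "c = lead_coeff g ^ (Suc (degree p) - degree g)"
  have eq: "smult c p = g * q + r" and deg: "r = 0 \<or> degree r < degree g"
    using pseudo_divmod[OF g0 qr] by (auto simp: c_def)
  have "poly (map_poly real_of_int (smult c p)) \<alpha> = poly (map_poly real_of_int (g * q + r)) \<alpha>"
    by (simp add: eq)
  then have r\<alpha>: "poly (map_poly real_of_int r) \<alpha> = 0"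
    using p root by (simp add: map_poly_smult map_poly_of_int_add map_poly_of_int_mult)
  have "degree r \<le> 1"
    using deg assms(4) by auto
  then have req: "r = [:coeff r 0, coeff r 1:]"
    by (intro poly_eqI) (auto simp: coeff_pCons coeff_eq_0 split: nat.splits)
  have lin: "real_of_int (coeff r 0) + real_of_int (coeff r 1) * \<alpha> = 0"
    using r\<alpha> by (subst (asm) req) (simp add: map_poly_pCons mult.commute)
  have "coeff r 1 = 0"
  proof (rule ccontr)
    assume "coeff r 1 \<noteq> 0"
    then have "\<alpha> = - real_of_int (coeff r 0) / real_of_int (coeff r 1)"
      using lin by (simp add: field_simps)
    then show False using assms(2) by auto
  qed
  then have "r = 0" using lin req by simp
  then have "g dvd smult c p" using eq by simp
  moreover have "c \<noteq> 0" using g0 by (simp add: c_def)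
  ultimately have "g dvd p"
    using assms(3) primitive_dvd_smult_imp_dvd by blast
  then obtain h where "p = g * h" by (elim dvdE)
  then have "lead_coeff g * lead_coeff h = 1"
    using p(2) by (simp add: lead_coeff_mult)
  then show ?thesis by (metis dvd_triv_left)
qed

text \<open>Clearing denominators and removing the content gives a primitive integer quadratic
  \<open>g\<close> vanishing at \<alpha>. Its leading coefficient is a unit, and \<open>u\<close>,
  \<open>v\<close> are the quotients of the other two coefficients by it.\<close>

lemma irrational_quadratic_algebraic_int_coeffs:
  fixes u v :: rat and \<alpha> :: real
  assumes "algebraic_int \<alpha>" "\<alpha> \<notin> \<rat>" "\<alpha>\<^sup>2 + of_rat u * \<alpha> + of_rat v = 0"
  shows "u \<in> \<int>" "v \<in> \<int>"
proof -
  obtain p q where u: "u = of_int p / of_int q" "q > 0"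
    by (metis quotient_of_denom_pos quotient_of_div surj_pair)
  obtain r s where v: "v = of_int r / of_int s" "s > 0"
    by (metis quotient_of_denom_pos quotient_of_div surj_pair)
  define g0 where "g0 = [:r * q, p * s, q * s:]"
  define g where "g = primitive_part g0"
  define c where "c = content g0"
  have g0: "g0 = smult c g"
    by (simp add: g_def c_def)
  have ne: "g0 \<noteq> 0" "c \<noteq> 0"
    using u v by (auto simp: g0_def c_def)
  have "real_of_int (q * s) * (\<alpha>\<^sup>2 + of_rat u * \<alpha> + of_rat v) = poly (map_poly of_int g0) \<alpha>"
    using u(2) v(2) unfolding u(1) v(1)
    by (simp add: g0_def map_poly_pCons of_rat_divide field_simps power2_eq_square)
  then have "poly (map_poly real_of_int g) \<alpha> = 0"
    using assms(3) ne by (simp add: g0 map_poly_smult)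
  moreover have "content g = 1"
    using ne by (simp add: g_def)
  moreover have dg: "degree g = 2"
    using u v by (simp add: g_def g0_def)
  ultimately have "lead_coeff g dvd 1"
    using assms(1,2) lead_coeff_primitive_quadratic_algebraic_int by blast
  then have unit: "\<bar>coeff g 2\<bar> = 1"
    using dg by simp
  have "coeff g0 i = c * coeff g i" for i
    by (simp add: g0)
  from this[of 0] this[of 1] this[of 2]
  have cf: "r * q = c * coeff g 0" "p * s = c * coeff g 1" "q * s = c * coeff g 2"
    by (simp_all add: g0_def numeral_2_eq_2)
  have "u = of_int (p * s) / of_int (q * s)" "v = of_int (r * q) / of_int (q * s)"
    using u v by simp_all
  then have "u = of_int (coeff g 1) / of_int (coeff g 2)"
      "v = of_int (coeff g 0) / of_int (coeff g 2)"
    unfolding cf using ne by simp_all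
  moreover have "coeff g 2 = 1 \<or> coeff g 2 = - 1"
    using unit by linarith
  ultimately show "u \<in> \<int>" "v \<in> \<int>"
    by auto
qed

text \<open>With \<open>y = p / q\<close> in lowest terms, \<open>q^2\<close> divides
  \<open>d * p^2\<close> and is coprime to \<open>p^2\<close>, so it divides the squarefree
  \<open>d\<close>.\<close>

lemma squarefree_mult_square_in_Ints:
  fixes y :: rat
  assumes "squarefree (d :: nat)" "of_nat d * y\<^sup>2 \<in> \<int>"
  shows "y \<in> \<int>"
proof -
  obtain p q where y: "y = of_int p / of_int q" "q > 0" "coprime p q"
    by (metis quotient_of_denom_pos quotient_of_div quotient_of_coprime surj_pair)
  obtain k where k: "of_nat d * y\<^sup>2 = (of_int k :: rat)"
    using assms(2) by (elim Ints_cases)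
  have "of_int (int d * p\<^sup>2) = (of_int (k * q\<^sup>2) :: rat)"
    using k y(2) by (simp add: y(1) field_simps)
  then have "int d * p\<^sup>2 = k * q\<^sup>2"
    by (simp only: of_int_eq_iff)
  then have "q\<^sup>2 dvd int d * p\<^sup>2" by simp
  moreover have "coprime (q\<^sup>2) (p\<^sup>2)"
    using y(3) by (simp add: coprime_commute)
  ultimately have "q\<^sup>2 dvd int d"
    by (simp add: coprime_dvd_mult_left_iff)
  then have "(nat q)\<^sup>2 dvd d"
    using y(2) by (metis int_dvd_int_iff int_nat_eq of_nat_power order_less_imp_le)
  then have "nat q dvd 1"
    using assms(1) by (rule squarefreeD[rotated])
  then have "q = 1"
    using y(2) by simp
  then show ?thesis
    using y by simp
qed

section \<open>Coordinates, conjugation and the radicand of a quadratic field\<close>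

text \<open>A rational algebraic integer is an integer, so rationality would make \<open>d\<close> a
  perfect square, which squarefreeness permits only for \<open>d = 1\<close>.\<close>

lemma sqrt_squarefree_irrational:
  assumes "quad_radicand d"
  shows "sqrt (real d) \<notin> \<rat>"
proof
  assume "sqrt (real d) \<in> \<rat>"
  moreover have "algebraic_int (sqrt (real d))"
    by (simp add: algebraic_int_sqrt int_imp_algebraic_int)
  ultimately have "sqrt (real d) \<in> \<int>"
    by (rule rational_algebraic_int_is_int[rotated])
  then obtain k where k: "sqrt (real d) = of_int k"
    by (elim Ints_cases)
  then have "real d = real_of_int (k\<^sup>2)"
    by (metis of_int_power of_nat_0_le_iff real_sqrt_pow2)
  then have "int d = k\<^sup>2" by linarith
  then have d: "d = (nat \<bar>k\<bar>)\<^sup>2"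
    by (metis nat_int nat_power_eq abs_ge_zero power2_abs)
  then have "nat \<bar>k\<bar> dvd 1"
    using assms unfolding quad_radicand_def by (metis dvd_refl squarefreeD)
  then show False
    using d assms by (simp add: quad_radicand_def)
qed

lemma quad_field_coords_unique:
  fixes x y x' y' :: rat
  assumes "quad_radicand d"
    and eq: "of_rat x + of_rat y * sqrt (real d) = of_rat x' + of_rat y' * sqrt (real d)"
  shows "x = x'" "y = y'"
proof -
  show "y = y'"
  proof (rule ccontr)
    assume "y \<noteq> y'"
    then have "sqrt (real d) = of_rat ((x' - x) / (y - y'))"
      using eq by (simp add: of_rat_divide of_rat_diff field_simps)
    then show False
      using sqrt_squarefree_irrational[OF assms(1)] by (metis Rats_of_rat)
  qed
  then show "x = x'" using eq by simp
qed

lemma quad_conj_eq: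
  assumes "quad_radicand d"
  shows "quad_conj d (of_rat x + of_rat y * sqrt (real d)) = of_rat x - of_rat y * sqrt (real d)"
  unfolding quad_conj_def
  by (rule the_equality) (use quad_field_coords_unique[OF assms] in blast)+

lemma quad_field_eqI:
  assumes "sqrt (real d1) = of_rat q * sqrt (real d2)" "d1 > 0"
  shows "quad_field d1 = quad_field d2"
proof -
  have q0: "q \<noteq> 0" using assms by auto
  have "of_rat x + of_rat y * sqrt (real d1) = of_rat x + of_rat (y * q) * sqrt (real d2)" for x y
    using assms(1) by (simp add: of_rat_mult)
  then have 1: "quad_field d1 \<subseteq> quad_field d2"
    unfolding quad_field_def by blast
  have "of_rat x + of_rat y * sqrt (real d2) = of_rat x + of_rat (y / q) * sqrt (real d1)" for x y
    using assms(1) q0 by (simp add: of_rat_divide)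
  then have "quad_field d2 \<subseteq> quad_field d1"
    unfolding quad_field_def by blast
  with 1 show ?thesis by blast
qed

text \<open>Lets fields be counted by their radicands. Squaring
  \<open>sqrt a = x + y * sqrt b\<close> and comparing coordinates gives \<open>x * y = 0\<close>;
  irrationality of \<open>sqrt a\<close> leaves \<open>a = b * y^2\<close>, and \<open>y\<close> is
  an integer because \<open>b\<close> is squarefree. So \<open>b\<close> divides \<open>a\<close>,
  and the roles are symmetric.\<close>

lemma quad_field_inj:
  assumes d1: "quad_radicand d1" and d2: "quad_radicand d2" and eq: "quad_field d1 = quad_field d2"
  shows "d1 = d2"
proof -
  have dvd: "b dvd a" if a: "quad_radicand a" and b: "quad_radicand b"
    and eq: "quad_field a = quad_field b" for a b
  proof -
    have "sqrt (real a) = of_rat 0 + of_rat 1 * sqrt (real a)" by simp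
    then have "sqrt (real a) \<in> quad_field b"
      unfolding eq[symmetric] unfolding quad_field_def by blast
    then obtain x y where xy: "sqrt (real a) = of_rat x + of_rat y * sqrt (real b)"
      unfolding quad_field_def by blast
    have "real a = (of_rat x + of_rat y * sqrt (real b))\<^sup>2"
      by (simp add: xy[symmetric])
    then have "of_rat (of_nat a) + of_rat 0 * sqrt (real b)
        = of_rat (x\<^sup>2 + of_nat b * y\<^sup>2) + of_rat (2 * x * y) * sqrt (real b)"
      by (simp add: power2_sum of_rat_add of_rat_mult of_rat_power power_mult_distrib mult.commute)
    from quad_field_coords_unique[OF b this]
    have *: "of_nat a = x\<^sup>2 + of_nat b * y\<^sup>2" "x = 0 \<or> y = 0" by simp_all
    have "y \<noteq> 0"
      using xy sqrt_squarefree_irrational[OF a] by auto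
    then have ay: "of_nat a = of_nat b * y\<^sup>2" using * by simp
    have "of_nat b * y\<^sup>2 \<in> \<int>"
      unfolding ay[symmetric] by (rule Ints_of_nat)
    moreover have "squarefree b"
      using b by (simp add: quad_radicand_def)
    ultimately have "y \<in> \<int>"
      using squarefree_mult_square_in_Ints by blast
    then obtain k where k: "y = of_int k" by (elim Ints_cases)
    have "rat_of_int (int a) = of_int (int b * k\<^sup>2)"
      using ay k by simp
    then have "int a = int b * k\<^sup>2" by (simp only: of_int_eq_iff)
    then have "int b dvd int a" by simp
    then show ?thesis by simp
  qed
  show ?thesis
    using dvd[OF d2 d1 eq[symmetric]] dvd[OF d1 d2 eq] by (rule dvd_antisym)
qed

section \<open>The ring of integers for radicands congruent to 3 modulo 4\<close>

text \<open>Trace \<open>2 * x\<close> and norm \<open>x^2 - d * y^2\<close> are integers, so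
  \<open>X = 2 * x\<close> and \<open>Y = 2 * y\<close> are integers with
  \<open>X^2 - d * Y^2\<close> divisible by 4. Since \<open>d\<close> is -1 modulo 4, so is
  \<open>X^2 + Y^2\<close>, which forces \<open>X\<close> and \<open>Y\<close> to be even.\<close>

lemma carrier_quad_int_ring_3_mod_4:
  assumes d: "quad_radicand d" and mod4: "d mod 4 = 3"
  shows "carrier (quad_int_ring d) = {of_int x + of_int y * sqrt (real d) | x y. True}"
proof (intro equalityI subsetI)
  fix \<alpha> assume "\<alpha> \<in> carrier (quad_int_ring d)"
  then obtain x y where \<alpha>: "\<alpha> = of_rat x + of_rat y * sqrt (real d)" and int: "algebraic_int \<alpha>"
    by (auto simp: quad_int_ring_def quad_field_def)
  show "\<alpha> \<in> {of_int x + of_int y * sqrt (real d) | x y. True}"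
  proof (cases "y = 0")
    case True
    then have "\<alpha> \<in> \<int>"
      using int \<alpha> by (intro rational_algebraic_int_is_int) auto
    then obtain k where "\<alpha> = of_int k" by (elim Ints_cases)
    then have "\<alpha> = of_int k + of_int 0 * sqrt (real d)" by simp
    then show ?thesis by blast
  next
    case False
    have "\<alpha> \<notin> \<rat>"
    proof
      assume "\<alpha> \<in> \<rat>"
      then obtain z where "\<alpha> = of_rat z + of_rat 0 * sqrt (real d)" by (auto elim: Rats_cases)
      then show False
        using quad_field_coords_unique[OF d] False \<alpha> by metis
    qed
    moreover have "\<alpha>\<^sup>2 + of_rat (- 2 * x) * \<alpha> + of_rat (x\<^sup>2 - of_nat d * y\<^sup>2) = 0"
      by (simp add: \<alpha> of_rat_minus of_rat_diff of_rat_mult of_rat_power algebra_simps power2_eq_square)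
    ultimately have "- 2 * x \<in> \<int>" "x\<^sup>2 - of_nat d * y\<^sup>2 \<in> \<int>"
      using irrational_quadratic_algebraic_int_coeffs[OF int] by blast+
    then obtain X N where X: "2 * x = of_int X" and N: "x\<^sup>2 - of_nat d * y\<^sup>2 = of_int N"
      by (auto elim!: Ints_cases simp: minus_equation_iff[of "2 * x"] simp flip: of_int_minus)
    \<comment> \<open>Scaling the norm by 4 brings in the integer \<open>2 * x\<close> and makes the
      squarefreeness argument applicable to \<open>2 * y\<close>.\<close>
    have "of_nat d * (2 * y)\<^sup>2 = (2 * x)\<^sup>2 - 4 * (x\<^sup>2 - of_nat d * y\<^sup>2)"
      by (simp add: algebra_simps power2_eq_square)
    also have "\<dots> = of_int (X\<^sup>2 - 4 * N)"
      unfolding X N by simp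
    finally have dY: "of_nat d * (2 * y)\<^sup>2 = of_int (X\<^sup>2 - 4 * N)" .
    have "of_nat d * (2 * y)\<^sup>2 \<in> \<int>"
      unfolding dY by (rule Ints_of_int)
    moreover have "squarefree d"
      using d by (simp add: quad_radicand_def)
    ultimately have "2 * y \<in> \<int>"
      using squarefree_mult_square_in_Ints by blast
    then obtain Y where Y: "2 * y = of_int Y" by (elim Ints_cases)
    have "rat_of_int (int d * Y\<^sup>2) = of_int (X\<^sup>2 - 4 * N)"
      using dY Y by simp
    then have "int d * Y\<^sup>2 = X\<^sup>2 - 4 * N" by (simp only: of_int_eq_iff)
    moreover have "int d = 4 * int (d div 4) + 3"
      using mod4 by presburger
    ultimately have "4 * (int (d div 4) * Y\<^sup>2 + N + Y\<^sup>2) = X\<^sup>2 + Y\<^sup>2"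
      by (simp add: algebra_simps)
    then have 4: "4 dvd X\<^sup>2 + Y\<^sup>2" by (metis dvd_triv_left)
    have "even X \<and> even Y"
    proof (rule ccontr)
      assume "\<not> (even X \<and> even Y)"
      moreover have "even (X\<^sup>2 + Y\<^sup>2)"
        using 4 by (rule dvd_trans[rotated]) simp
      ultimately have "odd X" "odd Y" by auto
      then obtain a b where ab: "X = 2 * a + 1" "Y = 2 * b + 1" by (auto elim!: oddE)
      have "X\<^sup>2 + Y\<^sup>2 = 4 * (a\<^sup>2 + a + b\<^sup>2 + b) + 2"
        unfolding ab by (simp add: power2_eq_square algebra_simps)
      then show False using 4 by presburger
    qed
    then obtain a b where "X = 2 * a" "Y = 2 * b" by (auto elim!: evenE)
    then have "x = of_int a" "y = of_int b" using X Y by simp_all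
    then have "\<alpha> = of_int a + of_int b * sqrt (real d)" using \<alpha> by simp
    then show ?thesis by blast
  qed
next
  fix \<alpha> assume "\<alpha> \<in> {of_int x + of_int y * sqrt (real d) | x y. True}"
  then obtain x y where \<alpha>: "\<alpha> = of_int x + of_int y * sqrt (real d)" by blast
  have "\<alpha> = of_rat (of_int x) + of_rat (of_int y) * sqrt (real d)" using \<alpha> by simp
  then have 1: "\<alpha> \<in> quad_field d" unfolding quad_field_def by blast
  \<comment> \<open>The monic polynomial whose roots are \<alpha> and its conjugate.\<close>
  have "poly (map_poly of_int [:x\<^sup>2 - int d * y\<^sup>2, - 2 * x, 1:]) \<alpha>
      = (\<alpha> - of_int x)\<^sup>2 - real d * (of_int y)\<^sup>2"
    by (simp add: map_poly_pCons power2_diff) (simp add: algebra_simps power2_eq_square)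
  also have "\<dots> = 0"
    by (simp add: \<alpha> power_mult_distrib)
  finally have "algebraic_int \<alpha>"
    unfolding algebraic_int_altdef_ipoly by (intro exI conjI) auto
  with 1 show "\<alpha> \<in> carrier (quad_int_ring d)" by (simp add: quad_int_ring_def)
qed

subsection \<open>Invariance of the determinant under similarity\<close>

definition cross2 :: "real ^ 2 \<Rightarrow> real ^ 2 \<Rightarrow> real" where
  "cross2 v w = v $ 1 * w $ 2 - v $ 2 * w $ 1"

text \<open>The determinant is multiplied by \<open>\<gamma>^2 * det U\<close>. Absolute values
  absorb the sign, since \<open>U\<close> may be a reflection.\<close>

lemma cross2_similarity:
  fixes U :: "real ^ 2 ^ 2"
  assumes "orthogonal_matrix U"
  shows "\<bar>cross2 (\<gamma> *\<^sub>R (U *v v)) (\<gamma> *\<^sub>R (U *v w))\<bar> = \<gamma>\<^sup>2 * \<bar>cross2 v w\<bar>"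
proof -
  have "cross2 (\<gamma> *\<^sub>R (U *v v)) (\<gamma> *\<^sub>R (U *v w)) = \<gamma>\<^sup>2 * (det U * cross2 v w)"
    by (simp add: cross2_def matrix_vector_mult_def det_2 sum_2 algebra_simps power2_eq_square)
  moreover have "\<bar>det U\<bar> = 1"
    using det_orthogonal_matrix[OF assms] by auto
  ultimately show ?thesis
    by (simp add: abs_mult)
qed

text \<open>Cramer's rule gives the coordinates of any \<open>u\<close> with respect to
  \<open>v\<close> and \<open>w\<close>.\<close>

lemma span_eq_UNIV_if_cross2:
  assumes "cross2 v w \<noteq> 0" "v \<in> M" "w \<in> M"
  shows "span M = UNIV"
proof -
  have "u \<in> span M" for u
  proof -
    have "cross2 v w * u $ i = cross2 u w * v $ i + cross2 v u * w $ i" for i :: 2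
      using exhaust_2[of i] by (auto simp: cross2_def algebra_simps)
    then have "u = (cross2 u w / cross2 v w) *\<^sub>R v + (cross2 v u / cross2 v w) *\<^sub>R w"
      using assms(1) by (simp add: vec_eq_iff add_divide_distrib[symmetric] nonzero_eq_divide_eq mult.commute)
    then show ?thesis
      using assms(2,3) by (metis span_add span_base span_scale)
  qed
  then show ?thesis by blast
qed

lemma cross2_nonzero_if_span_eq_UNIV:
  assumes "span M = UNIV"
  obtains v w where "v \<in> M" "w \<in> M" "cross2 v w \<noteq> 0"
proof (rule ccontr)
  assume *: "\<not> thesis"
  have sub: "subspace {w. cross2 v w = 0}" for v
    by (auto simp: subspace_def cross2_def algebra_simps)
  have "v = 0" if "v \<in> M" for v
  proof -
    have "M \<subseteq> {w. cross2 v w = 0}"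
      using that * \<open>\<And>v w. v \<in> M \<Longrightarrow> w \<in> M \<Longrightarrow> cross2 v w \<noteq> 0 \<Longrightarrow> thesis\<close> by blast
    then have "span M \<subseteq> {w. cross2 v w = 0}"
      using sub by (rule span_minimal)
    \<comment> \<open>The quarter turn of \<open>v\<close> has determinant \<open>|v|^2\<close> with
      \<open>v\<close>, so its lying in the span forces \<open>v = 0\<close>.\<close>
    then have "cross2 v (vector [- (v $ 2), v $ 1]) = 0"
      using assms by auto
    then show ?thesis
      by (simp add: cross2_def vec_eq_iff forall_2 sum_squares_eq_zero_iff)
  qed
  then have "M \<subseteq> {0}" by blast
  then have "span M \<subseteq> {0 :: real ^ 2}"
    by (metis span_mono span_insert_0 span_empty)
  then have "(axis 1 1 :: real ^ 2) = 0"
    using assms by blast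
  then show False by (simp add: axis_eq_0_iff)
qed

section \<open>Norms and determinants of embedded vectors, and the similarity invariant\<close>

lemma Lambda_eq:
  assumes "quad_radicand d"
  shows "Lambda d (of_rat x + of_rat y * sqrt (real d))
    = vector [of_rat x + of_rat y * sqrt (real d), of_rat x - of_rat y * sqrt (real d)]"
  using assms by (simp add: Lambda_def quad_conj_eq)

lemma norm_vector_conj:
  fixes a b s :: real
  shows "(norm (vector [a + b * s, a - b * s] :: real ^ 2))\<^sup>2 = 2 * (a\<^sup>2 + b\<^sup>2 * s\<^sup>2)"
  unfolding power2_norm_eq_inner
  by (simp add: inner_vec_def sum_2 power2_eq_square algebra_simps)

lemma norm_Lambda_Rats:
  assumes "quad_radicand d" "\<alpha> \<in> quad_field d"
  shows "\<exists>r. (norm (Lambda d \<alpha>))\<^sup>2 = of_rat r"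
proof -
  obtain x y where \<alpha>: "\<alpha> = of_rat x + of_rat y * sqrt (real d)"
    using assms(2) unfolding quad_field_def by blast
  have "(norm (Lambda d \<alpha>))\<^sup>2 = of_rat (2 * (x\<^sup>2 + y\<^sup>2 * of_nat d))"
    unfolding \<alpha> Lambda_eq[OF assms(1)] norm_vector_conj
    by (simp add: of_rat_mult of_rat_add of_rat_power)
  then show ?thesis by blast
qed

text \<open>Conjugation swaps the two coordinates of each vector and hence negates the determinant,
  so only the \<open>sqrt d\<close> part survives.\<close>

lemma cross2_Lambda:
  assumes "quad_radicand d" "\<alpha> \<in> quad_field d" "\<beta> \<in> quad_field d"
  shows "\<exists>r. cross2 (Lambda d \<alpha>) (Lambda d \<beta>) = of_rat r * sqrt (real d)"
proof -
  obtain x y where \<alpha>: "\<alpha> = of_rat x + of_rat y * sqrt (real d)"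
    using assms(2) unfolding quad_field_def by blast
  obtain x' y' where \<beta>: "\<beta> = of_rat x' + of_rat y' * sqrt (real d)"
    using assms(3) unfolding quad_field_def by blast
  have "cross2 (Lambda d \<alpha>) (Lambda d \<beta>) = of_rat (2 * (y * x' - x * y')) * sqrt (real d)"
    unfolding \<alpha> \<beta> Lambda_eq[OF assms(1)]
    by (simp add: cross2_def of_rat_mult of_rat_diff algebra_simps)
  then show ?thesis by blast
qed

lemma PWR_ideal_subset_quad_field:
  assumes "PWR_ideal d I"
  shows "I \<subseteq> quad_field d"
proof -
  have "ideal I (quad_int_ring d)"
    using assms by (auto simp: PWR_ideal_def principalideal_def)
  then have "I \<subseteq> carrier (quad_int_ring d)"
    by (auto dest: ideal.Icarr)
  then show ?thesis by (auto simp: quad_int_ring_def)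
qed

lemma similar_PWR_ideals_imp_same_field:
  assumes d1: "quad_radicand d1" and d2: "quad_radicand d2"
    and I1: "PWR_ideal d1 I1" and I2: "PWR_ideal d2 I2"
    and sim: "similar_ideals d1 I1 d2 I2"
  shows "quad_field d1 = quad_field d2"
proof -
  have sub: "I1 \<subseteq> quad_field d1" "I2 \<subseteq> quad_field d2"
    using I1 I2 PWR_ideal_subset_quad_field by blast+
  obtain \<gamma> U where \<gamma>: "\<gamma> > 0" and U: "orthogonal_matrix U"
    and im: "Lambda d2 ` I2 = (\<lambda>v. \<gamma> *\<^sub>R (U *v v)) ` Lambda d1 ` I1"
    using sim unfolding similar_ideals_def similar_lattices_def by blast
  have "span (minimal_vectors (Lambda d1 ` I1)) = UNIV"
    using I1 by (simp add: PWR_ideal_def well_rounded_def)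
  then obtain v w where "v \<in> minimal_vectors (Lambda d1 ` I1)"
      "w \<in> minimal_vectors (Lambda d1 ` I1)" and c0: "cross2 v w \<noteq> 0"
    by (rule cross2_nonzero_if_span_eq_UNIV)
  then obtain \<alpha> \<beta> where ab: "\<alpha> \<in> I1" "\<beta> \<in> I1" "v = Lambda d1 \<alpha>" "w = Lambda d1 \<beta>"
    by (auto simp: minimal_vectors_def)
  define v' w' where "v' = \<gamma> *\<^sub>R (U *v v)" and "w' = \<gamma> *\<^sub>R (U *v w)"
  have "v' \<in> Lambda d2 ` I2" "w' \<in> Lambda d2 ` I2"
    unfolding im v'_def w'_def ab(3,4) using ab(1,2) by blast+
  then obtain \<alpha>' \<beta>' where ab': "\<alpha>' \<in> I2" "\<beta>' \<in> I2" "v' = Lambda d2 \<alpha>'" "w' = Lambda d2 \<beta>'"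
    by blast
  obtain r n r' n' where r: "cross2 v w = of_rat r * sqrt (real d1)" "(norm v)\<^sup>2 = of_rat n"
      "cross2 v' w' = of_rat r' * sqrt (real d2)" "(norm v')\<^sup>2 = of_rat n'"
    using ab ab' sub norm_Lambda_Rats[OF d1, of \<alpha>] norm_Lambda_Rats[OF d2, of \<alpha>']
      cross2_Lambda[OF d1, of \<alpha> \<beta>] cross2_Lambda[OF d2, of \<alpha>' \<beta>'] by blast
  have c: "\<bar>cross2 v' w'\<bar> = \<gamma>\<^sup>2 * \<bar>cross2 v w\<bar>"
    unfolding v'_def w'_def by (rule cross2_similarity[OF U])
  have "norm (U *v v) = norm v"
    using U orthogonal_transformation_matrix[of "(*v) U"] 
    by (simp add: orthogonal_transformation_norm)
  then have nn: "(norm v')\<^sup>2 = \<gamma>\<^sup>2 * (norm v)\<^sup>2"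
    by (simp add: v'_def power_mult_distrib)
  have "v \<noteq> 0" using c0 by (auto simp: cross2_def)
  then have n0: "n \<noteq> 0" "n' \<noteq> 0" "r \<noteq> 0"
    using r nn \<gamma> c0 by auto
  \<comment> \<open>Determinant and squared norm both scale by \<open>\<gamma>^2\<close>;
    cross-multiplying eliminates the unknown \<open>\<gamma>\<close>.\<close>
  have "\<bar>cross2 v w\<bar> * (norm v')\<^sup>2 = \<bar>cross2 v' w'\<bar> * (norm v)\<^sup>2"
    using c nn by simp
  then have "\<bar>of_rat r\<bar> * of_rat n' * sqrt (real d1) = \<bar>of_rat r'\<bar> * of_rat n * sqrt (real d2)"
    unfolding r by (simp add: abs_mult ac_simps)
  moreover have "a = b / c * e" if "c * a = b * e" "c \<noteq> 0" for a b c e :: real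
    using that by (simp add: field_simps)
  ultimately have "sqrt (real d1)
      = \<bar>of_rat r'\<bar> * of_rat n / (\<bar>of_rat r\<bar> * of_rat n') * sqrt (real d2)"
    using n0 by simp
  then have "sqrt (real d1) = of_rat (\<bar>r'\<bar> * n / (\<bar>r\<bar> * n')) * sqrt (real d2)"
    by (simp only: of_rat_mult of_rat_divide abs_of_rat[symmetric])
  then show ?thesis
    by (rule quad_field_eqI) (use d1 in \<open>simp add: quad_radicand_def\<close>)
qed

subsection \<open>Odd squarefree numbers at distance two\<close>

text \<open>As 2 is invertible modulo the odd \<open>Q\<close>, all solutions lie in one residue
  class, so \<open>j div Q\<close> determines \<open>j\<close>.\<close>

lemma card_dvd_shift_le:
  fixes Q M r :: nat
  assumes "odd Q"
  shows "card {j. j < M \<and> Q dvd 2 * j + r} \<le> M div Q + 1"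
proof -
  have "inj_on (\<lambda>j. j div Q) {j. j < M \<and> Q dvd 2 * j + r}"
  proof (rule inj_onI; clarsimp)
    fix i j assume dv: "Q dvd 2 * i + r" "Q dvd 2 * j + r" and div: "i div Q = j div Q"
    have "int Q dvd int (2 * i + r) - int (2 * j + r)"
      using dv by (intro dvd_diff) (simp_all only: int_dvd_int_iff)
    then have "int Q dvd 2 * (int i - int j)"
      by (simp add: algebra_simps)
    then have "int Q dvd int i - int j"
      using assms by (subst (asm) coprime_dvd_mult_right_iff) auto
    then have "i mod Q = j mod Q"
      by (metis mod_eq_dvd_iff of_nat_mod of_nat_eq_iff)
    with div show "i = j" by (metis div_mult_mod_eq)
  qed
  then have "card {j. j < M \<and> Q dvd 2 * j + r}
      = card ((\<lambda>j. j div Q) ` {j. j < M \<and> Q dvd 2 * j + r})"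
    by (simp add: card_image)
  also have "\<dots> \<le> card {..M div Q}"
    by (intro card_mono) (auto intro: div_le_mono)
  finally show ?thesis by simp
qed

text \<open>Since \<open>(2 * i + 1)^2 > 4 * i * (i + 1)\<close>, the sum is dominated by a
  telescoping one; the induction carries its exact value.\<close>

lemma sum_inverse_odd_squares_le:
  "(\<Sum>i=1..R. 1 / (2 * real i + 1)\<^sup>2) \<le> 1 / 4"
proof -
  have "(\<Sum>i=1..R. 1 / (2 * real i + 1)\<^sup>2) \<le> 1 / 4 - 1 / (4 * (real R + 1))"
  proof (induction R)
    case (Suc R)
    have "1 / (2 * real (Suc R) + 1)\<^sup>2 \<le> 1 / (4 * (real R + 1) * (real R + 2))"
      by (intro divide_left_mono mult_pos_pos) (auto simp: power2_eq_square algebra_simps add_pos_nonneg)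
    also have "\<dots> = 1 / (4 * (real R + 1)) - 1 / (4 * (real (Suc R) + 1))"
      by (simp add: divide_simps)
    finally show ?case
      using Suc by simp
  qed simp
  then show ?thesis
    by (rule order_trans) simp
qed

text \<open>A square divisor of an odd number has an odd root \<open>2 * i + 1\<close>; being a
  non-unit gives \<open>i \<ge> 1\<close>, and the size of \<open>m\<close> gives
  \<open>i \<le> R\<close>.\<close>

lemma not_squarefree_odd_witness:
  fixes m :: nat
  assumes "\<not> squarefree m" "odd m" "m \<le> (2 * R + 1)\<^sup>2"
  obtains i where "i \<in> {1..R}" "(2 * i + 1)\<^sup>2 dvd m"
proof -
  obtain x where x: "x\<^sup>2 dvd m" "\<not> x dvd 1"
    using assms(1) by (rule not_squarefreeE)
  have "m > 0" using assms(2) by (cases m) auto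
  have "odd x"
    using x(1) assms(2) by (meson dvd_trans dvd_power zero_less_numeral)
  then obtain i where i: "x = 2 * i + 1" by (elim oddE)
  have "x\<^sup>2 \<le> (2 * R + 1)\<^sup>2"
    using dvd_imp_le[OF x(1) \<open>m > 0\<close>] assms(3) by (rule order_trans)
  then have "i \<le> R"
    using i by (simp only: power2_nat_le_eq_le)
  moreover have "i \<ge> 1" using x(2) i by (cases i) auto
  ultimately show ?thesis using that x(1) i by auto
qed

text \<open>
  Among the odd \<open>n = 2 * j + 1\<close> with \<open>j < M\<close>, at most \<open>M / q\<^sup>2 + 1\<close> are multiples of a given odd square
  \<open>q\<^sup>2\<close>, and likewise for \<open>n + 2\<close>. Summing over \<^emph>\<open>all\<close> odd \<open>q \<ge> 3\<close>, prime or not, excludes at most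
  \<open>M / 2 + O(sqrt M)\<close> values of \<open>j\<close>. The choice \<open>2 * M + 1 = (2 * R + 1)\<^sup>2\<close> makes \<open>R\<close> the exact range of
  relevant \<open>q = 2 * i + 1\<close>.
\<close>

lemma infinite_squarefree_odd_twins:
  "infinite {n :: nat. odd n \<and> squarefree n \<and> squarefree (n + 2)}"
proof
  assume fin: "finite {n :: nat. odd n \<and> squarefree n \<and> squarefree (n + 2)}"
  define G where "G = {j :: nat. squarefree (2 * j + 1) \<and> squarefree (2 * j + 3)}"
  have "(\<lambda>j. 2 * j + 1) ` G \<subseteq> {n. odd n \<and> squarefree n \<and> squarefree (n + 2)}"
    by (auto simp: G_def numeral_3_eq_3)
  then have "finite ((\<lambda>j. 2 * j + 1) ` G)"
    using fin by (rule finite_subset)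
  then have finG: "finite G"
    by (rule finite_imageD) (auto simp: inj_on_def)
  \<comment> \<open>The count will yield \<open>R^2 \<le> card G + R\<close>, which this value
    violates.\<close>
  define R where "R = card G + 2"
  define M where "M = 2 * R\<^sup>2 + 2 * R"
  have M: "2 * M + 1 = (2 * R + 1)\<^sup>2"
    by (simp add: M_def power2_eq_square algebra_simps)
  define B where "B r i = {j. j < M \<and> (2 * i + 1)\<^sup>2 dvd 2 * j + r}" for r i :: nat
  have cover: "{..<M} \<subseteq> G \<union> (\<Union>i\<in>{1..R}. B 1 i \<union> B 3 i)"
  proof
    fix j assume "j \<in> {..<M}"
    then have j: "j < M" by simp
    show "j \<in> G \<union> (\<Union>i\<in>{1..R}. B 1 i \<union> B 3 i)"
    proof (cases "j \<in> G")
      case False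
      then obtain r where r: "r = 1 \<or> r = 3" "\<not> squarefree (2 * j + r)"
        unfolding G_def by blast
      \<comment> \<open>The extreme case \<open>j = M - 1\<close>, \<open>r = 3\<close> gives
        exactly \<open>2 * M + 1\<close>.\<close>
      have "odd (2 * j + r)" "2 * j + r \<le> (2 * R + 1)\<^sup>2"
        using r(1) j M by auto
      with r(2) obtain i where "i \<in> {1..R}" "(2 * i + 1)\<^sup>2 dvd 2 * j + r"
        by (rule not_squarefree_odd_witness)
      then show ?thesis using r(1) j by (auto simp: B_def)
    qed simp
  qed
  have cardB: "real (card (B r i)) \<le> real M / (2 * real i + 1)\<^sup>2 + 1" for r i
  proof -
    have "card (B r i) \<le> M div (2 * i + 1)\<^sup>2 + 1"
      unfolding B_def by (rule card_dvd_shift_le) simp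
    then have "real (card (B r i)) \<le> real (M div (2 * i + 1)\<^sup>2) + 1"
      by linarith
    also have "real (M div (2 * i + 1)\<^sup>2) \<le> real M / (2 * real i + 1)\<^sup>2"
      using of_nat_div_le_of_nat[of M "(2 * i + 1)\<^sup>2", where 'a=real] by (simp add: add.commute)
    finally show ?thesis by simp
  qed
  have finB: "finite (B r i)" for r i by (simp add: B_def)
  have "M = card {..<M}" by simp
  also have "\<dots> \<le> card (G \<union> (\<Union>i\<in>{1..R}. B 1 i \<union> B 3 i))"
    using cover finG finB by (intro card_mono) auto
  also have "\<dots> \<le> card G + card (\<Union>i\<in>{1..R}. B 1 i \<union> B 3 i)"
    by (rule card_Un_le)
  also have "card (\<Union>i\<in>{1..R}. B 1 i \<union> B 3 i) \<le> (\<Sum>i=1..R. card (B 1 i \<union> B 3 i))"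
    by (rule card_UN_le) simp
  also have "\<dots> \<le> (\<Sum>i=1..R. card (B 1 i) + card (B 3 i))"
    by (intro sum_mono card_Un_le)
  finally have "real M \<le> real (card G + (\<Sum>i=1..R. card (B 1 i) + card (B 3 i)))"
    by (simp only: of_nat_le_iff add_left_mono)
  also have "\<dots> = real (card G) + (\<Sum>i=1..R. real (card (B 1 i)) + real (card (B 3 i)))"
    by simp
  also have "\<dots> \<le> real (card G) + (\<Sum>i=1..R. 2 * (real M * (1 / (2 * real i + 1)\<^sup>2) + 1))"
  proof (intro add_left_mono sum_mono)
    fix i
    show "real (card (B 1 i)) + real (card (B 3 i)) \<le> 2 * (real M * (1 / (2 * real i + 1)\<^sup>2) + 1)"
      using cardB[of 1 i] cardB[of 3 i] by simp
  qed
  also have "\<dots> = real (card G) + 2 * real M * (\<Sum>i=1..R. 1 / (2 * real i + 1)\<^sup>2) + 2 * real R"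
    by (simp add: sum.distrib sum_distrib_left)
  also have "\<dots> \<le> real (card G) + 2 * real M * (1 / 4) + 2 * real R"
    by (intro add_mono mult_left_mono sum_inverse_odd_squares_le) auto
  finally have "real M \<le> 2 * real (card G) + 4 * real R" by simp
  moreover have "real M = 2 * (real R)\<^sup>2 + 2 * real R" by (simp add: M_def)
  moreover have "real R = real (card G) + 2" by (simp add: R_def)
  ultimately have "2 * (real (card G))\<^sup>2 + 4 * real (card G) + 4 \<le> 0"
    by (simp add: power2_eq_square algebra_simps)
  moreover have "(real (card G))\<^sup>2 \<ge> 0" by simp
  ultimately show False by linarith
qed

subsection \<open>A family of well-rounded principal ideals\<close>

text \<open>Closure is read off the integer coordinates, with \<open>sqrt d\<close> squaring to
  \<open>d\<close>; the remaining laws are those of the reals.\<close>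

lemma cring_quad_int_ring_3_mod_4:
  assumes "quad_radicand d" "d mod 4 = 3"
  shows "cring (quad_int_ring d)"
proof -
  define C where "C = {of_int x + of_int y * sqrt (real d) | x y. True}"
  have C: "carrier (quad_int_ring d) = C"
    unfolding C_def by (rule carrier_quad_int_ring_3_mod_4[OF assms])
  have ops: "mult (quad_int_ring d) = (*)" "add (quad_int_ring d) = (+)"
      "one (quad_int_ring d) = 1" "zero (quad_int_ring d) = 0"
    by (simp_all add: quad_int_ring_def)
  have memI: "of_int x + of_int y * sqrt (real d) \<in> C" for x y
    unfolding C_def by blast
  have closed: "a + b \<in> C \<and> a * b \<in> C \<and> - a \<in> C" if ab: "a \<in> C" "b \<in> C" for a b
  proof -
    obtain x y x' y' where a: "a = of_int x + of_int y * sqrt (real d)"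
        and b: "b = of_int x' + of_int y' * sqrt (real d)"
      using ab unfolding C_def by blast
    have "a + b = of_int (x + x') + of_int (y + y') * sqrt (real d)"
      by (simp add: a b algebra_simps)
    moreover have "a * b = of_int (x * x' + int d * (y * y')) + of_int (x * y' + y * x') * sqrt (real d)"
      by (simp add: a b algebra_simps)
    moreover have "- a = of_int (- x) + of_int (- y) * sqrt (real d)"
      by (simp add: a)
    ultimately show ?thesis by (metis memI)
  qed
  have C01: "0 \<in> C" "1 \<in> C"
    using memI[of 0 0] memI[of 1 0] by simp_all
  show ?thesis
  proof (intro cringI abelian_groupI comm_monoidI)
    fix a assume "a \<in> carrier (quad_int_ring d)"
    then show "\<exists>b\<in>carrier (quad_int_ring d). b \<oplus>\<^bsub>quad_int_ring d\<^esub> a = \<zero>\<^bsub>quad_int_ring d\<^esub>"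
      using closed unfolding C ops by (intro bexI[of _ "- a"]) auto
  qed (use closed C01 in \<open>auto simp: C ops algebra_simps\<close>)
qed

text \<open>A common divisor of \<open>n\<close> and \<open>n + 2\<close> divides 2, so the odd
  factors are coprime and their product stays squarefree.\<close>

lemma quad_radicand_odd_twin_product:
  assumes "odd n" "squarefree n" "squarefree (n + 2)"
  shows "quad_radicand (n * (n + 2))" "n * (n + 2) mod 4 = 3"
proof -
  have "coprime n (n + 2)"
    using assms(1) by (metis coprime_iff_gcd_eq_1 coprime_right_2_iff_odd gcd_add2)
  moreover have "n * (n + 2) > 1"
    using assms(1) by (cases n) auto
  ultimately show "quad_radicand (n * (n + 2))"
    unfolding quad_radicand_def using assms(2,3) by (blast intro: squarefree_mult_coprime)
  obtain k where k: "n = 2 * k + 1" using assms(1) by (elim oddE)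
  have "n * (n + 2) = 4 * (k\<^sup>2 + 2 * k) + 3"
    unfolding k by (simp add: power2_eq_square algebra_simps)
  then show "n * (n + 2) mod 4 = 3" by presburger
qed

text \<open>The bound is the value at \<open>r, t = 1\<close> or \<open>-1\<close>. If one variable
  vanishes, parity makes the other a nonzero even number, whose square is at least 4, and
  \<open>4 * n \<ge> 2 * n + 2\<close>.\<close>

lemma twin_form_lower_bound:
  fixes n r t :: int
  assumes "n \<ge> 1" "even (r - t)" "r \<noteq> 0 \<or> t \<noteq> 0"
  shows "2 * n + 2 \<le> n * r\<^sup>2 + (n + 2) * t\<^sup>2"
proof -
  have one: "1 \<le> x\<^sup>2" if "x \<noteq> 0" for x :: int
    using that by (simp add: int_one_le_iff_zero_less)
  have four: "4 \<le> x\<^sup>2" if "x \<noteq> 0" "even x" for x :: int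
  proof -
    obtain y where "x = 2 * y" using \<open>even x\<close> by (elim evenE)
    then show ?thesis using one[of y] \<open>x \<noteq> 0\<close> by (simp add: power_mult_distrib)
  qed
  consider "r = 0" | "t = 0" | "r \<noteq> 0" "t \<noteq> 0" by blast
  then show ?thesis
  proof cases
    case 1
    then have "(n + 2) * 4 \<le> (n + 2) * t\<^sup>2"
      using assms by (intro mult_left_mono four) auto
    then show ?thesis using 1 assms(1) by simp
  next
    case 2
    then have "n * 4 \<le> n * r\<^sup>2"
      using assms by (intro mult_left_mono four) auto
    moreover have "(n + 2) * t\<^sup>2 = 0" using 2 by simp
    ultimately show ?thesis using assms(1) by linarith
  next
    case 3
    then have "n * 1 \<le> n * r\<^sup>2" "(n + 2) * 1 \<le> (n + 2) * t\<^sup>2"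
      using assms(1) by (intro mult_left_mono one; simp)+
    then show ?thesis by simp
  qed
qed

text \<open>A lower bound on the norm holds for all nonzero vectors of the lattice and is attained
  at two independent ones.\<close>

lemma PWR_ideal_odd_twin_product:
  assumes n: "odd n" "squarefree n" "squarefree (n + 2)"
  shows "\<exists>I. PWR_ideal (n * (n + 2)) I"
proof -
  define d where "d = n * (n + 2)"
  define s where "s = sqrt (real d)"
  define R where "R = quad_int_ring d"
  define I where "I = PIdl\<^bsub>R\<^esub> (real n + s)"
  have d: "quad_radicand d" and mod4: "d mod 4 = 3"
    unfolding d_def using quad_radicand_odd_twin_product[OF n] by blast+
  interpret cring R
    unfolding R_def by (rule cring_quad_int_ring_3_mod_4[OF d mod4])
  have carr: "carrier R = {of_int x + of_int y * s | x y. True}"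
    unfolding R_def s_def by (rule carrier_quad_int_ring_3_mod_4[OF d mod4])
  have n1: "n \<ge> 1" using n(1) by (cases n) auto
  have ss: "s * s = real n * (real n + 2)"
    by (simp add: s_def d_def algebra_simps)
  have s0: "s > 0"
    using d by (simp add: s_def quad_radicand_def)
  have "real n + s = of_int (int n) + of_int 1 * s" by simp
  then have \<alpha>: "real n + s \<in> carrier R"
    unfolding carr by blast
  have I: "I = {a * (real n + s) | a. a \<in> carrier R}"
    unfolding I_def cgenideal_def by (simp add: R_def quad_int_ring_def)
  have principal: "principalideal I R"
    unfolding I_def using \<alpha> by (rule cgenideal_is_principalideal)
  have mul: "(of_int x + of_int y * s) * (real n + s)
      = of_int (int n * (x + y * (int n + 2))) + of_int (x + y * int n) * s" for x y
  proof -
    have "(of_int x + of_int y * s) * (real n + s)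
        = of_int x * real n + of_int y * (s * s) + of_int (x + y * int n) * s"
      by (simp add: algebra_simps)
    then show ?thesis unfolding ss by (simp add: algebra_simps)
  qed
  have I_cases: "\<exists>r t. \<alpha> = of_int (int n * r) + of_int t * s \<and> even (r - t)" if "\<alpha> \<in> I" for \<alpha>
  proof -
    obtain x y where "\<alpha> = (of_int x + of_int y * s) * (real n + s)"
      using \<open>\<alpha> \<in> I\<close> unfolding I carr by blast
    then have "\<alpha> = of_int (int n * (x + y * (int n + 2))) + of_int (x + y * int n) * s"
      by (simp only: mul)
    \<comment> \<open>The difference is \<open>2 * y\<close>.\<close>
    moreover have "even ((x + y * (int n + 2)) - (x + y * int n))"
      by (simp add: algebra_simps)
    ultimately show ?thesis by blast
  qed
  have "1 \<in> carrier R"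
    using one_closed by (simp add: R_def quad_int_ring_def)
  then have g1: "real n + s \<in> I"
    unfolding I by (auto intro: exI[of _ 1])
  \<comment> \<open>The cofactor \<open>n + 1 - s\<close> is the inverse of the unit
    \<open>n + 1 + s\<close>, because \<open>(n + 1)^2 - n * (n + 2) = 1\<close>.\<close>
  have "- real n + s = (of_int (int n + 1) + of_int (- 1) * s) * (real n + s)"
    unfolding mul by (simp add: algebra_simps)
  then have g2: "- real n + s \<in> I"
    unfolding I carr by blast
  have Lam: "Lambda d (of_int x + of_int y * s) = vector [of_int x + of_int y * s, of_int x - of_int y * s]" for x y
    using Lambda_eq[OF d, of "of_int x" "of_int y"] by (simp add: s_def)
  have L1: "Lambda d (real n + s) = vector [real n + s, real n - s]"
    using Lam[of "int n" 1] by simp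
  have L2: "Lambda d (- real n + s) = vector [- real n + s, - real n - s]"
    using Lam[of "- int n" 1] by simp
  have norm_Lam: "(norm (Lambda d (of_int (int n * r) + of_int t * s)))\<^sup>2
      = of_int (2 * int n * (int n * r\<^sup>2 + (int n + 2) * t\<^sup>2))" for r t
  proof -
    have "(norm (Lambda d (of_int (int n * r) + of_int t * s)))\<^sup>2
        = 2 * ((of_int (int n * r))\<^sup>2 + (of_int t)\<^sup>2 * (s * s))"
      unfolding Lam norm_vector_conj by (simp add: power2_eq_square)
    then show ?thesis unfolding ss by (simp add: power2_eq_square algebra_simps)
  qed
  have norm_ge: "of_int (2 * int n * (2 * int n + 2)) \<le> (norm w)\<^sup>2"
    if "w \<in> Lambda d ` I" "w \<noteq> 0" for w
  proof -
    obtain r t where w: "w = Lambda d (of_int (int n * r) + of_int t * s)" and ev: "even (r - t)"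
      using \<open>w \<in> Lambda d ` I\<close> I_cases by blast
    have "r \<noteq> 0 \<or> t \<noteq> 0"
      using \<open>w \<noteq> 0\<close> norm_Lam[of r t] unfolding w[symmetric] by auto
    then have "2 * int n + 2 \<le> int n * r\<^sup>2 + (int n + 2) * t\<^sup>2"
      using ev n1 by (intro twin_form_lower_bound) auto
    then show ?thesis
      unfolding w norm_Lam of_int_le_iff by (intro mult_left_mono) auto
  qed
  have minimal: "Lambda d (of_int (int n * r) + of_int t * s) \<in> minimal_vectors (Lambda d ` I)"
    if "of_int (int n * r) + of_int t * s \<in> I" "r\<^sup>2 = 1" "t\<^sup>2 = 1" for r t
  proof -
    let ?v = "Lambda d (of_int (int n * r) + of_int t * s)"
    have eq: "(norm ?v)\<^sup>2 = of_int (2 * int n * (2 * int n + 2))"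
      unfolding norm_Lam using that by (simp add: algebra_simps)
    then have "?v \<noteq> 0" using n1 by auto
    moreover have "norm ?v \<le> norm w" if "w \<in> Lambda d ` I" "w \<noteq> 0" for w
    proof (rule power2_le_imp_le)
      show "(norm ?v)\<^sup>2 \<le> (norm w)\<^sup>2"
        unfolding eq by (rule norm_ge[OF that])
    qed simp
    ultimately show ?thesis
      using that(1) unfolding minimal_vectors_def by blast
  qed
  have "cross2 (Lambda d (real n + s)) (Lambda d (- real n + s)) = - 4 * real n * s"
    unfolding L1 L2 by (simp add: cross2_def algebra_simps)
  then have "cross2 (Lambda d (real n + s)) (Lambda d (- real n + s)) \<noteq> 0"
    using n1 s0 by simp
  moreover have "Lambda d (real n + s) \<in> minimal_vectors (Lambda d ` I)"
    using minimal[of 1 1] g1 by simp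
  moreover have "Lambda d (- real n + s) \<in> minimal_vectors (Lambda d ` I)"
    using minimal[of "- 1" 1] g2 by simp
  ultimately have "well_rounded (Lambda d ` I)"
    unfolding well_rounded_def by (rule span_eq_UNIV_if_cross2)
  moreover have "I \<noteq> {0}" using g1 s0 by force
  ultimately show ?thesis
    using principal unfolding PWR_ideal_def R_def d_def by blast
qed

section \<open>Infinitely many fields and pairwise non-similar ideals\<close>

theorem theorem5p10:
  shows "infinite {K :: real set. \<exists>d. quad_radicand d \<and> K = quad_field d \<and> (\<exists>I. PWR_ideal d I)}
    \<and> (\<forall>d1 d2 I1 I2.
          quad_radicand d1 \<and> quad_radicand d2 \<and> quad_field d1 \<noteq> quad_field d2 \<and>
          PWR_ideal d1 I1 \<and> PWR_ideal d2 I2 \<longrightarrow> \<not> similar_ideals d1 I1 d2 I2)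
    \<and> (\<exists>S :: (nat \<times> real set) set.
          infinite S \<and> (\<forall>(d, I) \<in> S. quad_radicand d \<and> PWR_ideal d I) \<and>
          pairwise (\<lambda>(d1, I1) (d2, I2). \<not> similar_ideals d1 I1 d2 I2) S)"
proof -
  define D where "D = {d. quad_radicand d \<and> (\<exists>I. PWR_ideal d I)}"
  \<comment> \<open>One arbitrary PWR ideal per radicand suffices, because non-similarity depends
    only on the fields being distinct.\<close>
  define J where "J d = (SOME I. PWR_ideal d I)" for d
  have "(\<lambda>n. n * (n + 2)) ` {n. odd n \<and> squarefree n \<and> squarefree (n + 2)} \<subseteq> D"
    unfolding D_def using quad_radicand_odd_twin_product(1) PWR_ideal_odd_twin_product by blast
  moreover have "inj (\<lambda>n :: nat. n * (n + 2))"
    by (rule strict_mono_imp_inj_on, rule strict_monoI, rule mult_strict_mono) auto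
  ultimately have infD: "infinite D"
    using infinite_squarefree_odd_twins by (meson finite_imageD finite_subset inj_on_subset top_greatest)
  have inj: "inj_on quad_field D"
    using quad_field_inj unfolding D_def by (intro inj_onI) blast
  have J: "PWR_ideal d (J d)" if "d \<in> D" for d
    using that unfolding D_def J_def by (auto intro: someI_ex)
  have "{K. \<exists>d. quad_radicand d \<and> K = quad_field d \<and> (\<exists>I. PWR_ideal d I)} = quad_field ` D"
    unfolding D_def by blast
  then have 1: "infinite {K. \<exists>d. quad_radicand d \<and> K = quad_field d \<and> (\<exists>I. PWR_ideal d I)}"
    using infD inj by (simp add: finite_image_iff)
  have 2: "\<not> similar_ideals d1 I1 d2 I2"
    if "quad_radicand d1" "quad_radicand d2" "quad_field d1 \<noteq> quad_field d2"
      "PWR_ideal d1 I1" "PWR_ideal d2 I2" for d1 d2 I1 I2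
    using similar_PWR_ideals_imp_same_field that by blast
  define S where "S = (\<lambda>d. (d, J d)) ` D"
  have "infinite S"
    unfolding S_def using infD by (simp add: finite_image_iff inj_on_def)
  moreover have "\<forall>(d, I) \<in> S. quad_radicand d \<and> PWR_ideal d I"
    unfolding S_def using J by (auto simp: D_def)
  moreover have "pairwise (\<lambda>(d1, I1) (d2, I2). \<not> similar_ideals d1 I1 d2 I2) S"
  proof -
    \<comment> \<open>Distinct radicands give distinct fields, so the second claim applies.\<close>
    have "\<not> similar_ideals a (J a) b (J b)" if "a \<in> D" "b \<in> D" "a \<noteq> b" for a b
      using that inj by (intro 2 J) (auto simp: D_def dest: inj_onD)
    then show ?thesis
      unfolding S_def by (auto simp: pairwise_def)
  qed
  ultimately show ?thesis
    using 1 2 by blast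
qed

end
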